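(* For all $n\ge1$, in $\mathbf{sNSym}$, $$\tilde S_n=\sum_{k=0}^nR_{(1^k,\dot0,1^{n-k})}+\sum_{k=1}^nR_{(1^{k-1},\dot1,1^{n-k})},$$ where $1^j$ stands for $j$ consecutive entries equal to $1$.
   Context: Let $\mathbb N=\{1,2,\ldots\}$ and $\dot{\mathbb N}_0=\{\dot0,\dot1,\dot2,\ldots\}$ (dotted copies of the nonnegative integers). A dotted composition is a finite tuple $\alpha=(\alpha_1,\ldots,\alpha_k)$ with entries in $\mathbb N\cup\dot{\mathbb N}_0$. For entries not both dotted put $m\oplus n=m+n$ and $m\oplus\dot n=\dot m\oplus n=\dot r$ with $r=m+n$. The partial order $\preceq$ on dotted compositions is the reflexive-transitive closure of the relation: $\beta$ is obtained from $\alpha$ by replacing two consecutive entries $x,y$ of $\alpha$ that are not both dotted by the single entry $x\oplus y$ (then $\alpha\preceq\beta$). $\mathbf{sNSym}$, as an algebra, is the free associative unital $\mathbb Q$-algebra on generators $H_n$ ($n\in\mathbb N$) and $H_{\dot n}=\tilde H_n$ ($n\ge0$), with $H_0=1$; $H_\alpha:=H_{\alpha_1}\cdots H_{\alpha_k}$. The noncommutative Ribbon Schur functions in superspace $R_\alpha$ are defined recursively by $R_\alpha=H_\alpha-\sum_{\alpha\prec\beta}R_\beta$. The noncommutative elementary functions in superspace $S_n,\tilde S_n$ are defined by the generating function identity $\sigma(t,\tau)\lambda(-t,-\tau)=1$, where $\lambda(t,\tau)=\sum_{n\ge0}t^n(H_n+\tau\tilde H_n)$, $\sigma(t,\tau)=\sum_{n\ge0}t^n(S_n+\tau\tilde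 S_n)$ and $\tau^2=0$. Explicitly: $S_0=1$, $\sum_{k=0}^n(-1)^{n-k}S_kH_{n-k}=0$ for $n\ge1$, and $\sum_{k=0}^n(-1)^{n-k}(S_k\tilde H_{n-k}-\tilde S_kH_{n-k})=0$ for $n\ge0$. *)

theory Defs
  imports Complex_Main "HOL-Library.Poly_Mapping"
begin

section \<open>Dotted compositions\<close>

text \<open>The type \<^typ>\<open>num\<close> consists of the positive integers, so \<open>Plain\<close> entries range over
  \<open>1, 2, \<dots>\<close> and \<open>Dot\<close> entries over the dotted nonnegative integers.  A dotted composition is an
  arbitrary list of entries, possibly empty.\<close>

datatype entry = Plain num | Dot nat

type_synonym dotted_composition = "entry list"

text \<open>\<open>oplus\<close> is only meaningful when its arguments are not both dotted.\<close>

fun oplus :: "entry \<Rightarrow> entry \<Rightarrow> entry" where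
  "oplus (Plain m) (Plain n) = Plain (m + n)"
| "oplus (Plain m) (Dot n) = Dot (nat_of_num m + n)"
| "oplus (Dot m) (Plain n) = Dot (m + nat_of_num n)"
| "oplus (Dot m) (Dot n) = undefined"

fun dotted :: "entry \<Rightarrow> bool" where
  "dotted (Plain n) = False"
| "dotted (Dot n) = True"

inductive merge :: "dotted_composition \<Rightarrow> dotted_composition \<Rightarrow> bool" where
  "\<not> (dotted x \<and> dotted y) \<Longrightarrow> merge (us @ [x, y] @ vs) (us @ [oplus x y] @ vs)"

definition dc_le :: "dotted_composition \<Rightarrow> dotted_composition \<Rightarrow> bool" where
  "dc_le = merge\<^sup>*\<^sup>*"

definition dc_less :: "dotted_composition \<Rightarrow> dotted_composition \<Rightarrow> bool" where
  "dc_less \<alpha> \<beta> \<longleftrightarrow> dc_le \<alpha> \<beta> \<and> \<alpha> \<noteq> \<beta>"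

lemma merge_length: "merge \<alpha> \<beta> \<Longrightarrow> length \<alpha> = Suc (length \<beta>)"
  by (auto elim: merge.cases)

lemma dc_le_length: "dc_le \<alpha> \<beta> \<Longrightarrow> length \<beta> < length \<alpha> \<or> \<alpha> = \<beta>"
  unfolding dc_le_def by (induction rule: rtranclp_induct) (auto dest: merge_length)

lemma dc_less_length: "dc_less \<alpha> \<beta> \<Longrightarrow> length \<beta> < length \<alpha>"
  unfolding dc_less_def using dc_le_length by blast

lemma finite_merge: "finite {\<beta>. merge \<alpha> \<beta>}"
proof (rule finite_subset)
  let ?f = "\<lambda>i. take i \<alpha> @ [oplus (\<alpha> ! i) (\<alpha> ! Suc i)] @ drop (i + 2) \<alpha>"
  show "{\<beta>. merge \<alpha> \<beta>} \<subseteq> ?f ` {..<length \<alpha>}"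
  proof
    fix \<beta> assume "\<beta> \<in> {\<beta>. merge \<alpha> \<beta>}"
    then have "merge \<alpha> \<beta>" by simp
    then obtain x y us vs where *: "\<alpha> = us @ [x, y] @ vs" "\<beta> = us @ [oplus x y] @ vs"
      by cases blast
    have "\<beta> = ?f (length us)" by (simp add: * nth_append)
    then show "\<beta> \<in> ?f ` {..<length \<alpha>}" using * by (intro image_eqI[of _ _ "length us"]) auto
  qed
qed simp

lemma finite_dc_le: "finite {\<beta>. dc_le \<alpha> \<beta>}"
proof (induction "length \<alpha>" arbitrary: \<alpha> rule: less_induct)
  case less
  have "{\<beta>. dc_le \<alpha> \<beta>} \<subseteq> insert \<alpha> (\<Union>\<gamma>\<in>{\<gamma>. merge \<alpha> \<gamma>}. {\<beta>. dc_le \<gamma> \<beta>})"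
    unfolding dc_le_def by (auto elim: converse_rtranclpE)
  moreover have "finite \<dots>"
    using less by (auto simp: finite_merge merge_length)
  ultimately show ?case by (rule finite_subset)
qed

text \<open>The sum in the recursion for the ribbon functions is therefore over a finite set.\<close>

lemma finite_dc_less: "finite {\<beta>. dc_less \<alpha> \<beta>}"
  by (rule finite_subset[OF _ finite_dc_le[of \<alpha>]]) (auto simp: dc_less_def)


section \<open>The algebra sNSym\<close>

text \<open>The free associative unital algebra over the rationals on a set of generators is the monoid
  algebra of the free monoid on that set.  For an additively written monoid \<open>M\<close>, the type
  \<open>M \<Rightarrow>\<^sub>0 rat\<close> of finitely supported functions carries the convolution product, so it is
  enough to make words an additive monoid under concatenation.\<close>

datatype 'a free_monoid = Word (letters: "'a list")

instantiation free_monoid :: (type) monoid_add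
begin

definition zero_free_monoid :: "'a free_monoid" where
  "0 = Word []"

definition plus_free_monoid :: "'a free_monoid \<Rightarrow> 'a free_monoid \<Rightarrow> 'a free_monoid" where
  "v + w = Word (letters v @ letters w)"

instance
  by standard (simp_all add: zero_free_monoid_def plus_free_monoid_def)

end

type_synonym sNSym = "entry free_monoid \<Rightarrow>\<^sub>0 rat"

definition gen :: "entry \<Rightarrow> sNSym" where
  "gen x = Poly_Mapping.single (Word [x]) 1"

definition H :: "nat \<Rightarrow> sNSym" where
  "H n = (if n = 0 then 1 else gen (Plain (num_of_nat n)))"

definition Ht :: "nat \<Rightarrow> sNSym" where
  "Ht n = gen (Dot n)"

definition H_comp :: "dotted_composition \<Rightarrow> sNSym" where
  "H_comp \<alpha> = prod_list (map gen \<alpha>)"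

lemma H_comp_eq_single: "H_comp \<alpha> = Poly_Mapping.single (Word \<alpha>) 1"
proof (induction \<alpha>)
  case Nil
  show ?case by (simp add: H_comp_def flip: zero_free_monoid_def)
next
  case (Cons x \<alpha>)
  then show ?case
    by (simp add: H_comp_def gen_def mult_single plus_free_monoid_def)
qed


section \<open>Ribbon functions\<close>

function R :: "dotted_composition \<Rightarrow> sNSym" where
  "R \<alpha> = H_comp \<alpha> - (\<Sum>\<beta>\<in>{\<beta>. dc_less \<alpha> \<beta>}. R \<beta>)"
  by auto
termination
  by (relation "measure length") (auto intro: dc_less_length)

declare R.simps [simp del]


section \<open>Elementary functions\<close>

text \<open>The two families are obtained by solving the coefficient identities of
  \<open>\<sigma>(t,\<tau>) \<lambda>(-t,-\<tau>) = 1\<close> for the term with \<open>k = n\<close>.  Lemma \<open>elementary_iff\<close> below states that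
  these identities hold and determine the families.\<close>

function S :: "nat \<Rightarrow> sNSym" where
  "S n = (if n = 0 then 1 else - (\<Sum>k<n. (-1) ^ (n - k) * (S k * H (n - k))))"
  by auto
termination
  by (relation "measure id") auto

declare S.simps [simp del]

function St :: "nat \<Rightarrow> sNSym" where
  "St n = (\<Sum>k=0..n. (-1) ^ (n - k) * (S k * Ht (n - k)))
        - (\<Sum>k<n. (-1) ^ (n - k) * (St k * H (n - k)))"
  by auto
termination
  by (relation "measure id") auto

declare St.simps [simp del]

lemma elementary_iff:
  fixes S' St' :: "nat \<Rightarrow> sNSym"
  shows "S' 0 = 1
     \<and> (\<forall>n\<ge>1. (\<Sum>k=0..n. (-1) ^ (n - k) * (S' k * H (n - k))) = 0)
     \<and> (\<forall>n. (\<Sum>k=0..n. (-1) ^ (n - k) * (S' k * Ht (n - k) - St' k * H (n - k))) = 0)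
     \<longleftrightarrow> S' = S \<and> St' = St" (is "?zero \<and> ?even \<and> ?odd \<longleftrightarrow> _")
proof -
  have split: "(\<Sum>k=0..n. f k) = (\<Sum>k<n. f k) + f n" for f :: "nat \<Rightarrow> sNSym" and n
    by (simp add: atLeast0AtMost flip: lessThan_Suc_atMost)
  have H0: "H 0 = 1" by (simp add: H_def)
  have even: "(\<Sum>k=0..n. (-1) ^ (n - k) * (S' k * H (n - k))) = 0
      \<longleftrightarrow> S' n = - (\<Sum>k<n. (-1) ^ (n - k) * (S' k * H (n - k)))" for n
    unfolding split by (simp add: H0 add_eq_0_iff)
  have odd: "(\<Sum>k=0..n. (-1) ^ (n - k) * (S' k * Ht (n - k) - St' k * H (n - k))) = 0
      \<longleftrightarrow> St' n = (\<Sum>k=0..n. (-1) ^ (n - k) * (S' k * Ht (n - k)))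
                - (\<Sum>k<n. (-1) ^ (n - k) * (St' k * H (n - k)))" for n
  proof -
    have eq: "(\<Sum>k=0..n. (-1) ^ (n - k) * (S' k * Ht (n - k) - St' k * H (n - k)))
        = (\<Sum>k=0..n. (-1) ^ (n - k) * (S' k * Ht (n - k)))
          - ((\<Sum>k<n. (-1) ^ (n - k) * (St' k * H (n - k))) + St' n)"
      unfolding right_diff_distrib sum_subtractf
      using split[of "\<lambda>k. (-1) ^ (n - k) * (St' k * H (n - k))" n] by (simp add: H0)
    have solve: "a - (b + c) = 0 \<longleftrightarrow> c = a - b" for a b c :: sNSym
      by (auto simp: algebra_simps)
    show ?thesis unfolding eq by (rule solve)
  qed
  show ?thesis
  proof
    assume eqs: "S' = S \<and> St' = St"
    have "S 0 = 1" by (simp add: S.simps[of 0])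
    moreover have "S n = - (\<Sum>k<n. (-1) ^ (n - k) * (S k * H (n - k)))" if "n \<ge> 1" for n
      using that by (subst S.simps) simp
    ultimately show "?zero \<and> ?even \<and> ?odd"
      unfolding even odd using eqs St.simps by blast
  next
    assume asm: "?zero \<and> ?even \<and> ?odd"
    have S: "S' n = S n" for n
    proof (induction n rule: less_induct)
      case (less n)
      show ?case
      proof (cases "n = 0")
        case True
        then show ?thesis using asm by (simp add: S.simps[of 0])
      next
        case False
        then have "S' n = - (\<Sum>k<n. (-1) ^ (n - k) * (S' k * H (n - k)))"
          by (intro iffD1[OF even]) (use asm in simp)
        also have "\<dots> = S n" using False less by (simp add: S.simps[of n])
        finally show ?thesis .
      qed
    qed
    have "St' n = St n" for n
    proof (induction n rule: less_induct)
      case (less n)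
      have "St' n = (\<Sum>k=0..n. (-1) ^ (n - k) * (S' k * Ht (n - k)))
                - (\<Sum>k<n. (-1) ^ (n - k) * (St' k * H (n - k)))"
        by (intro iffD1[OF odd]) (use asm in blast)
      also have "\<dots> = St n" using less by (simp add: St.simps[of n] S)
      finally show ?case .
    qed
    with S show "S' = S \<and> St' = St" by blast
  qed
qed

end

theory Submission
  imports Defs
begin

text \<open>
  Everything rests on the multiplication rule for ribbon functions (\<open>R_mult_R\<close>): the product
  \<open>R\<^sub>\<alpha> R\<^sub>\<beta>\<close> is \<open>R\<close> of the concatenation plus, if the two entries that meet are not both dotted,
  \<open>R\<close> of the near-concatenation, in which these two entries are added.  Its source is a recursive
  description of coarsenings (\<open>coarsenings_Cons\<close>): a coarsening of \<open>x # \<alpha>\<close> either keeps \<open>x\<close> as its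
  own entry or absorbs it into the first entry of a coarsening of \<open>\<alpha>\<close>, and each coarsening arises
  exactly once.  Since the \<open>R\<^sub>\<beta>\<close> with \<open>\<beta>\<close> coarser than or equal to \<open>\<alpha>\<close> add up to \<open>H\<^sub>\<alpha>\<close>, and
  \<open>H\<^bsub>x # \<alpha>\<^esub> = H\<^sub>x H\<^sub>\<alpha>\<close>, the rule for \<open>\<alpha> = (x)\<close> follows by induction.

  The elementary functions are the unique solution of two families of alternating identities
  (\<open>elementary_iff\<close>), so it suffices that \<open>R\<close> of \<open>1\<^sup>n\<close> in the role of \<open>S\<^sub>n\<close>, and the claimed sums,
  here \<open>A\<^sub>n\<close>, in the role of \<open>S\<close>-tilde, satisfy them.  By the multiplication rule, a product with
  \<open>H\<^bsub>n-k\<^esub>\<close> or its dotted version has a part where the last entry \<open>n - k\<close> stays separate and a part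
  where it has swallowed the entry before it.  The latter is the former for \<open>k - 1\<close>, so the
  alternating sums telescope.  What survives is nothing in the undotted identity.  In
  the dotted identity \<open>R\<close> of \<open>(1\<^sup>n, 0)\<close> with dotted \<open>0\<close> survives twice, from the products
  \<open>S\<^sub>k H\<close>-tilde and from the products \<open>A\<^sub>k H\<close>, and cancels.  The summands of \<open>A\<^sub>k\<close> with a dotted
  \<open>1\<close> are needed for this second telescoping: appending a \<open>1\<close> to the compositions of
  \<open>A\<^bsub>k-1\<^esub>\<close> yields those of \<open>A\<^sub>k\<close> except the two that end with their dotted entry.  Multiplied with
  \<open>H\<^bsub>n-k\<^esub>\<close>, these two yield the merged entries \<open>n - k\<close> and \<open>n - k + 1\<close>, both dotted, which are
  again consecutive terms of a telescoping sum.
\<close>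

section \<open>Coarsenings and the first entry\<close>

abbreviation mergeable :: "entry \<Rightarrow> entry \<Rightarrow> bool" where
  "mergeable x y \<equiv> \<not> (dotted x \<and> dotted y)"

definition near_concat :: "dotted_composition \<Rightarrow> dotted_composition \<Rightarrow> dotted_composition" where
  "near_concat \<alpha> \<beta> = butlast \<alpha> @ oplus (last \<alpha>) (hd \<beta>) # tl \<beta>"

lemma dotted_oplus: "mergeable x y \<Longrightarrow> dotted (oplus x y) \<longleftrightarrow> dotted x \<or> dotted y"
  by (cases x; cases y) auto

lemma oplus_assoc:
  assumes "mergeable x y" "mergeable y z" "mergeable x z"
  shows "oplus (oplus x y) z = oplus x (oplus y z)"
  using assms by (cases x; cases y; cases z) (auto simp: num_eq_iff nat_of_num_add)

lemma oplus_left_cancel: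
  "mergeable x y \<Longrightarrow> mergeable x z \<Longrightarrow> oplus x y = oplus x z \<longleftrightarrow> y = z"
  by (cases x; cases y; cases z) (auto simp: num_eq_iff nat_of_num_add)

lemma oplus_neq_left: "mergeable x y \<Longrightarrow> oplus x y \<noteq> x"
  using nat_of_num_pos by (cases x; cases y) (auto simp: num_eq_iff nat_of_num_add)

lemma merge_Cons:
  "merge (x # \<alpha>) \<gamma> \<longleftrightarrow>
     (\<exists>\<beta>. merge \<alpha> \<beta> \<and> \<gamma> = x # \<beta>) \<or>
     (\<alpha> \<noteq> [] \<and> mergeable x (hd \<alpha>) \<and> \<gamma> = near_concat [x] \<alpha>)"
proof
  assume "merge (x # \<alpha>) \<gamma>"
  then obtain u v us vs where *: "mergeable u v" "x # \<alpha> = us @ [u, v] @ vs"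
      "\<gamma> = us @ [oplus u v] @ vs"
    by cases blast
  then show "(\<exists>\<beta>. merge \<alpha> \<beta> \<and> \<gamma> = x # \<beta>) \<or>
     (\<alpha> \<noteq> [] \<and> mergeable x (hd \<alpha>) \<and> \<gamma> = near_concat [x] \<alpha>)"
    using merge.intros[OF *(1), of "tl us" vs] by (cases us) (auto simp: near_concat_def)
next
  assume "(\<exists>\<beta>. merge \<alpha> \<beta> \<and> \<gamma> = x # \<beta>) \<or>
     (\<alpha> \<noteq> [] \<and> mergeable x (hd \<alpha>) \<and> \<gamma> = near_concat [x] \<alpha>)"
  then show "merge (x # \<alpha>) \<gamma>"
  proof (elim disjE exE conjE)
    fix \<beta> assume "merge \<alpha> \<beta>" "\<gamma> = x # \<beta>"
    then show ?thesis
      by (metis append_Cons merge.simps)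
  next
    assume "\<alpha> \<noteq> []" "mergeable x (hd \<alpha>)" "\<gamma> = near_concat [x] \<alpha>"
    then show ?thesis
      using merge.intros[of x "hd \<alpha>" "[]" "tl \<alpha>"] by (simp add: near_concat_def)
  qed
qed

lemma dc_le_refl [simp]: "dc_le \<alpha> \<alpha>"
  by (simp add: dc_le_def)

lemma dc_le_merge: "dc_le \<alpha> \<beta> \<Longrightarrow> merge \<beta> \<gamma> \<Longrightarrow> dc_le \<alpha> \<gamma>"
  unfolding dc_le_def by (rule rtranclp.rtrancl_into_rtrancl)

lemma dc_le_Cons: "dc_le \<alpha> \<beta> \<Longrightarrow> dc_le (x # \<alpha>) (x # \<beta>)"
  unfolding dc_le_def
  by (induction rule: rtranclp_induct) (auto intro: rtranclp.rtrancl_into_rtrancl simp: merge_Cons)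

lemma dc_le_not_Nil: "dc_le \<alpha> \<beta> \<Longrightarrow> \<alpha> \<noteq> [] \<Longrightarrow> \<beta> \<noteq> []"
  unfolding dc_le_def by (induction rule: rtranclp_induct) (auto elim: merge.cases)

lemma dc_le_minimal: "length \<alpha> \<le> 1 \<Longrightarrow> dc_le \<alpha> \<beta> \<longleftrightarrow> \<beta> = \<alpha>"
  using dc_le_length[of \<alpha> \<beta>] dc_le_not_Nil[of \<alpha> \<beta>] by (cases \<alpha>) auto

text \<open>The case where the merge hits the first entry, which is already the sum of \<open>x\<close> and the first
  entry of \<open>\<beta>\<close>, is where associativity of \<open>oplus\<close> enters: merging inside \<open>\<beta>\<close> first and adding
  \<open>x\<close> afterwards gives the same composition.\<close>

lemma near_concat_merge:
  assumes "mergeable x (hd \<beta>)" "merge (near_concat [x] \<beta>) \<gamma>" "\<beta> \<noteq> []"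
  shows "\<exists>\<delta>. merge \<beta> \<delta> \<and> mergeable x (hd \<delta>) \<and> \<gamma> = near_concat [x] \<delta>"
proof -
  obtain y \<beta>' where \<beta>: "\<beta> = y # \<beta>'" using assms(3) by (cases \<beta>) auto
  from assms(2) consider
      \<beta>'' where "merge \<beta>' \<beta>''" "\<gamma> = oplus x y # \<beta>''"
    | "\<beta>' \<noteq> []" "mergeable (oplus x y) (hd \<beta>')" "\<gamma> = near_concat [oplus x y] \<beta>'"
    by (auto simp: near_concat_def \<beta> merge_Cons)
  then show ?thesis
  proof cases
    case 1
    then show ?thesis
      using assms(1) by (intro exI[of _ "y # \<beta>''"]) (simp add: \<beta> merge_Cons near_concat_def)
  next
    case 2
    then show ?thesis
      using assms(1) dotted_oplus[of x y] dotted_oplus[of y "hd \<beta>'"]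
      by (intro exI[of _ "near_concat [y] \<beta>'"])
        (auto simp: \<beta> merge_Cons near_concat_def oplus_assoc)
  qed
qed

text \<open>The right-hand side contains \<open>x # \<alpha>\<close> and is closed under merging, hence contains every
  coarsening.\<close>

lemma coarsenings_Cons:
  assumes "\<alpha> \<noteq> []"
  shows "{\<gamma>. dc_le (x # \<alpha>) \<gamma>} =
    (#) x ` {\<beta>. dc_le \<alpha> \<beta>} \<union> near_concat [x] ` {\<beta>. dc_le \<alpha> \<beta> \<and> mergeable x (hd \<beta>)}"
    (is "?C = ?A \<union> ?B")
proof (intro equalityI subsetI)
  fix \<gamma> assume "\<gamma> \<in> ?C"
  then have "merge\<^sup>*\<^sup>* (x # \<alpha>) \<gamma>" by (simp add: dc_le_def)
  then show "\<gamma> \<in> ?A \<union> ?B"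
  proof (induction rule: rtranclp_induct)
    case base
    then show ?case by simp
  next
    case (step \<gamma> \<delta>)
    then show ?case
    proof (elim UnE imageE)
      fix \<beta> assume "\<gamma> = x # \<beta>" "\<beta> \<in> {\<beta>. dc_le \<alpha> \<beta>}"
      then show ?thesis
        using step.hyps(2) by (auto simp: merge_Cons intro: dc_le_merge)
    next
      fix \<beta> assume \<beta>: "\<gamma> = near_concat [x] \<beta>" "\<beta> \<in> {\<beta>. dc_le \<alpha> \<beta> \<and> mergeable x (hd \<beta>)}"
      then obtain \<beta>' where "merge \<beta> \<beta>'" "mergeable x (hd \<beta>')" "\<delta> = near_concat [x] \<beta>'"
        using near_concat_merge step.hyps(2) dc_le_not_Nil assms by blast
      then show ?thesis using \<beta>(2) by (blast intro: dc_le_merge)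
    qed
  qed
next
  fix \<gamma> assume "\<gamma> \<in> ?A \<union> ?B"
  then show "\<gamma> \<in> ?C"
  proof (elim UnE imageE)
    fix \<beta> assume \<beta>: "\<gamma> = near_concat [x] \<beta>" "\<beta> \<in> {\<beta>. dc_le \<alpha> \<beta> \<and> mergeable x (hd \<beta>)}"
    then have "merge (x # \<beta>) \<gamma>" using assms by (auto simp: merge_Cons dest: dc_le_not_Nil)
    then show ?thesis using \<beta> by (auto intro: dc_le_merge dc_le_Cons)
  qed (auto intro: dc_le_Cons)
qed

text \<open>The two kinds of coarsenings do not overlap, because adding an entry to \<open>x\<close> always changes
  \<open>x\<close>: either the size grows or, when a dotted \<open>0\<close> is added to an undotted entry, a dot appears.
  Within each kind the coarsening of \<open>\<alpha>\<close> can be recovered, by cancelling \<open>x\<close>.\<close>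

lemma sum_coarsenings_Cons:
  fixes f :: "dotted_composition \<Rightarrow> 'a::comm_monoid_add"
  assumes "\<alpha> \<noteq> []"
  shows "(\<Sum>\<gamma> | dc_le (x # \<alpha>) \<gamma>. f \<gamma>) =
    (\<Sum>\<beta> | dc_le \<alpha> \<beta>. f (x # \<beta>) + (if mergeable x (hd \<beta>) then f (near_concat [x] \<beta>) else 0))"
proof -
  let ?M = "{\<beta>. dc_le \<alpha> \<beta> \<and> mergeable x (hd \<beta>)}"
  have nonempty: "\<beta> \<noteq> []" if "dc_le \<alpha> \<beta>" for \<beta> using that assms dc_le_not_Nil by blast
  have inj: "inj_on (near_concat [x]) ?M"
    by (rule inj_onI)
      (auto simp: near_concat_def oplus_left_cancel intro: list.expand dest: nonempty)
  have "(\<Sum>\<gamma> | dc_le (x # \<alpha>) \<gamma>. f \<gamma>) =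
      sum f ((#) x ` {\<beta>. dc_le \<alpha> \<beta>}) + sum f (near_concat [x] ` ?M)"
    unfolding coarsenings_Cons[OF assms]
  proof (rule sum.union_disjoint)
    show "(#) x ` {\<beta>. dc_le \<alpha> \<beta>} \<inter> near_concat [x] ` ?M = {}"
    proof -
      have "x # \<beta> \<noteq> near_concat [x] \<beta>'" if "mergeable x (hd \<beta>')" for \<beta> \<beta>'
        using oplus_neq_left[OF that] by (auto simp: near_concat_def)
      then show ?thesis by blast
    qed
  qed (use finite_dc_le[of \<alpha>] in \<open>auto intro: finite_subset[of ?M]\<close>)
  also have "\<dots> = (\<Sum>\<beta> | dc_le \<alpha> \<beta>. f (x # \<beta>)) + (\<Sum>\<beta>\<in>?M. f (near_concat [x] \<beta>))"
    by (simp only: sum.reindex[OF inj] sum.reindex[OF inj_on_Cons1] o_def)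
  also have "(\<Sum>\<beta>\<in>?M. f (near_concat [x] \<beta>)) =
      (\<Sum>\<beta> | dc_le \<alpha> \<beta>. if mergeable x (hd \<beta>) then f (near_concat [x] \<beta>) else 0)"
    using sum.inter_filter[OF finite_dc_le[of \<alpha>],
        of "\<lambda>\<beta>. f (near_concat [x] \<beta>)" "\<lambda>\<beta>. mergeable x (hd \<beta>)"] by simp
  finally show ?thesis by (simp add: sum.distrib)
qed


section \<open>Products of ribbon functions\<close>

lemma sum_R_coarsenings: "(\<Sum>\<beta> | dc_le \<alpha> \<beta>. R \<beta>) = H_comp \<alpha>"
proof -
  have "{\<beta>. dc_le \<alpha> \<beta>} = insert \<alpha> {\<beta>. dc_less \<alpha> \<beta>}" by (auto simp: dc_less_def)
  moreover have "\<alpha> \<notin> {\<beta>. dc_less \<alpha> \<beta>}" by (simp add: dc_less_def)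
  ultimately show ?thesis by (simp add: finite_dc_less R.simps[of \<alpha>])
qed

lemma R_Nil: "R [] = 1"
  using sum_R_coarsenings[of "[]"] by (simp add: dc_le_minimal H_comp_def)

lemma R_singleton: "R [x] = gen x"
  using sum_R_coarsenings[of "[x]"] by (simp add: dc_le_minimal H_comp_def)

text \<open>Summed over all coarsenings \<open>\<beta>\<close> of \<open>\<alpha>\<close>, the two sides agree: both sums equal \<open>H\<close> of
  \<open>x # \<alpha>\<close>.  By induction they agree for every proper coarsening, so they agree for \<open>\<alpha>\<close>.\<close>

lemma gen_mult_R:
  "\<alpha> \<noteq> [] \<Longrightarrow>
    gen x * R \<alpha> = R (x # \<alpha>) + (if mergeable x (hd \<alpha>) then R (near_concat [x] \<alpha>) else 0)"
proof (induction "length \<alpha>" arbitrary: \<alpha> rule: less_induct)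
  case less
  define rhs where
    "rhs \<beta> = R (x # \<beta>) + (if mergeable x (hd \<beta>) then R (near_concat [x] \<beta>) else 0)" for \<beta>
  have "(\<Sum>\<beta> | dc_le \<alpha> \<beta>. gen x * R \<beta>) = H_comp (x # \<alpha>)"
    by (simp add: H_comp_def sum_R_coarsenings flip: sum_distrib_left)
  also have "\<dots> = (\<Sum>\<beta> | dc_le \<alpha> \<beta>. rhs \<beta>)"
    unfolding rhs_def by (simp only: sum_R_coarsenings flip: sum_coarsenings_Cons[OF less.prems])
  finally have sums: "(\<Sum>\<beta> | dc_le \<alpha> \<beta>. gen x * R \<beta>) = (\<Sum>\<beta> | dc_le \<alpha> \<beta>. rhs \<beta>)" .
  have "(\<Sum>\<beta>\<in>{\<beta>. dc_le \<alpha> \<beta>} - {\<alpha>}. gen x * R \<beta>) = (\<Sum>\<beta>\<in>{\<beta>. dc_le \<alpha> \<beta>} - {\<alpha>}. rhs \<beta>)"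
    unfolding rhs_def
    using less.hyps dc_le_length dc_le_not_Nil less.prems by (intro sum.cong refl) blast
  with sums have "gen x * R \<alpha> = rhs \<alpha>"
    by (simp add: sum.remove[OF finite_dc_le[of \<alpha>], of \<alpha>])
  then show ?case by (simp add: rhs_def)
qed

text \<open>Splitting off the first entry \<open>x\<close> of \<open>\<alpha>\<close> expresses \<open>R \<alpha>\<close> by ribbon functions of shorter
  compositions.  The products then contain unwanted terms in which \<open>x\<close> is merged with its
  successor; these cancel.\<close>

lemma R_mult_R:
  "\<lbrakk>\<alpha> \<noteq> []; \<beta> \<noteq> []\<rbrakk> \<Longrightarrow> R \<alpha> * R \<beta> =
    R (\<alpha> @ \<beta>) + (if mergeable (last \<alpha>) (hd \<beta>) then R (near_concat \<alpha> \<beta>) else 0)"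
proof (induction "length \<alpha>" arbitrary: \<alpha> rule: less_induct)
  case less
  define mg where "mg u v \<gamma> = (if mergeable u v then R \<gamma> else 0)" for u v \<gamma>
  obtain x \<gamma> where \<alpha>: "\<alpha> = x # \<gamma>" using less.prems(1) by (cases \<alpha>) auto
  show ?case
  proof (cases \<gamma>)
    case Nil
    then show ?thesis using less.prems(2) by (simp add: \<alpha> R_singleton gen_mult_R)
  next
    case (Cons y \<delta>)
    have IH: "R \<epsilon> * R \<beta> =
        R (\<epsilon> @ \<beta>) + (if mergeable (last \<epsilon>) (hd \<beta>) then R (near_concat \<epsilon> \<beta>) else 0)"
      if "length \<epsilon> < length \<alpha>" "\<epsilon> \<noteq> []" for \<epsilon>
      using less.hyps[OF that(1,2) less.prems(2)] .
    have gen: "gen x * R \<epsilon> = R (x # \<epsilon>) + mg x (hd \<epsilon>) (near_concat [x] \<epsilon>)" if "\<epsilon> \<noteq> []" for \<epsilon>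
      unfolding mg_def using gen_mult_R[OF that] .
    \<comment> \<open>Merging at both ends of \<open>\<gamma>\<close> gives the same term in either order.  Only for \<open>\<gamma> = [y]\<close> do the
      two merges interact; then both sides require that at most one of \<open>x\<close>, \<open>y\<close>, \<open>hd \<beta>\<close> is
      dotted.\<close>
    have merged_twice:
      "(if mergeable (last \<gamma>) (hd \<beta>)
          then mg x (hd (near_concat \<gamma> \<beta>)) (near_concat [x] (near_concat \<gamma> \<beta>)) else 0) =
       (if mergeable x y \<and> mergeable (last (near_concat [x] \<gamma>)) (hd \<beta>)
          then R (near_concat (near_concat [x] \<gamma>) \<beta>) else 0)"
    proof (cases \<delta>)
      case Nil
      then show ?thesis
        using dotted_oplus[of x y] dotted_oplus[of y "hd \<beta>"]
        by (auto simp: Cons near_concat_def mg_def oplus_assoc)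
    next
      case (Cons z \<delta>')
      then show ?thesis by (simp add: \<open>\<gamma> = y # \<delta>\<close> near_concat_def mg_def)
    qed
    have "R \<alpha> = gen x * R \<gamma> - mg x y (near_concat [x] \<gamma>)"
      using gen[of \<gamma>] by (simp add: \<alpha> Cons)
    then have "R \<alpha> * R \<beta> = gen x * (R \<gamma> * R \<beta>) - mg x y (near_concat [x] \<gamma>) * R \<beta>"
      by (simp add: left_diff_distrib mult.assoc)
    also have "gen x * (R \<gamma> * R \<beta>) =
        R (\<alpha> @ \<beta>) + mg x y (near_concat [x] \<gamma> @ \<beta>) +
        (if mergeable (last \<gamma>) (hd \<beta>) then R (near_concat \<alpha> \<beta>) +
          mg x (hd (near_concat \<gamma> \<beta>)) (near_concat [x] (near_concat \<gamma> \<beta>)) else 0)"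
    proof -
      have "gen x * R (near_concat \<gamma> \<beta>) = R (near_concat \<alpha> \<beta>) +
          mg x (hd (near_concat \<gamma> \<beta>)) (near_concat [x] (near_concat \<gamma> \<beta>))"
        using gen[of "near_concat \<gamma> \<beta>"] by (simp add: near_concat_def \<alpha> Cons)
      moreover have "gen x * R (\<gamma> @ \<beta>) = R (\<alpha> @ \<beta>) + mg x y (near_concat [x] \<gamma> @ \<beta>)"
        using gen[of "\<gamma> @ \<beta>"] by (simp add: near_concat_def \<alpha> Cons)
      ultimately show ?thesis
        using IH[of \<gamma>] by (simp add: \<alpha> Cons distrib_left)
    qed
    also have "mg x y (near_concat [x] \<gamma>) * R \<beta> = mg x y (near_concat [x] \<gamma> @ \<beta>) +
        (if mergeable x y \<and> mergeable (last (near_concat [x] \<gamma>)) (hd \<beta>)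
          then R (near_concat (near_concat [x] \<gamma>) \<beta>) else 0)"
      using IH[of "near_concat [x] \<gamma>"] by (simp add: mg_def near_concat_def \<alpha> Cons)
    finally show ?thesis
      unfolding merged_twice[symmetric] by (simp add: \<alpha> Cons)
  qed
qed

lemma R_snoc_mult_gen:
  "R (\<alpha> @ [x]) * gen y =
    R (\<alpha> @ [x, y]) + (if mergeable x y then R (\<alpha> @ [oplus x y]) else 0)"
  using R_mult_R[of "\<alpha> @ [x]" "[y]"] by (simp add: R_singleton near_concat_def)


section \<open>Elementary functions as sums of ribbon functions\<close>

lemma alternating_sum_telescope:
  fixes a h :: "nat \<Rightarrow> 'a::ring_1"
  assumes "a 0 = h 0" and "\<And>k. k < n \<Longrightarrow> a (Suc k) = h (Suc k) + h k"
  shows "(\<Sum>k=0..n. (-1) ^ (n - k) * a k) = h n"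
  using assms(2)
proof (induction n)
  case 0
  then show ?case by (simp add: assms(1))
next
  case (Suc n)
  have "(\<Sum>k=0..n. (-1) ^ (Suc n - k) * a k) = - (\<Sum>k=0..n. (-1) ^ (n - k) * a k)"
    unfolding sum_negf[symmetric] by (intro sum.cong) (auto simp: Suc_diff_le)
  then show ?case using Suc by simp
qed

abbreviation ones :: "nat \<Rightarrow> dotted_composition" where
  "ones k \<equiv> replicate k (Plain num.One)"

abbreviation plain :: "nat \<Rightarrow> entry" where
  "plain m \<equiv> Plain (num_of_nat m)"

lemma oplus_plain_right:
  assumes "m > 0"
  shows "oplus (Plain num.One) (plain m) = plain (Suc m)" "oplus (Dot a) (plain m) = Dot (a + m)"
  using assms by (simp_all add: num_of_nat_inverse num_of_nat_plus_distrib[of 1 m, simplified])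

lemma H_pos: "m > 0 \<Longrightarrow> H m = gen (plain m)"
  by (simp add: H_def)

lemma R_ones_mult_Ht:
  "R (ones (Suc k)) * Ht m = R (ones (Suc k) @ [Dot m]) + R (ones k @ [Dot (Suc m)])"
  using R_snoc_mult_gen[of "ones k" "Plain num.One" "Dot m"]
  by (simp add: Ht_def replicate_append_same[symmetric])

lemma R_append_ones_mult_H:
  assumes "m > 0"
  shows "R (us @ ones (Suc k)) * H m =
    R (us @ ones (Suc k) @ [plain m]) + R (us @ ones k @ [plain (Suc m)])"
  using R_snoc_mult_gen[of "us @ ones k" "Plain num.One" "plain m",
      unfolded oplus_plain_right[OF assms]] assms
  by (simp add: H_pos replicate_append_same[symmetric])

lemma R_snoc_Dot_mult_H:
  assumes "m > 0"
  shows "R (us @ [Dot a]) * H m = R (us @ [Dot a, plain m]) + R (us @ [Dot (a + m)])"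
  using R_snoc_mult_gen[of us "Dot a" "plain m", unfolded oplus_plain_right[OF assms]] assms
  by (simp add: H_pos)

text \<open>In the telescoping, the term for \<open>k = n\<close> would have a last entry \<open>0\<close>, which is not an
  undotted entry; its place is taken by zero, since multiplication by \<open>H 0 = 1\<close> appends
  nothing.\<close>

lemma alternating_sum_R_ones_H:
  assumes "n \<ge> 1"
  shows "(\<Sum>k=0..n. (-1) ^ (n - k) * (R (ones k) * H (n - k))) = 0"
proof -
  define h where "h k = (if k < n then R (ones k @ [plain (n - k)]) else 0)" for k
  have "(\<Sum>k=0..n. (-1) ^ (n - k) * (R (ones k) * H (n - k))) = h n"
  proof (rule alternating_sum_telescope)
    show "R (ones 0) * H (n - 0) = h 0"
      using assms by (simp add: h_def R_Nil R_singleton H_pos)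
    show "R (ones (Suc k)) * H (n - Suc k) = h (Suc k) + h k" if "k < n" for k
    proof (cases "Suc k = n")
      case True
      then show ?thesis by (auto simp: h_def H_def replicate_append_same)
    next
      case False
      then show ?thesis
        using that R_append_ones_mult_H[of "n - Suc k" "[]" k] by (simp add: h_def Suc_diff_Suc)
    qed
  qed
  then show ?thesis by (simp add: h_def)
qed

lemma alternating_sum_R_ones_Ht:
  "(\<Sum>k=0..n. (-1) ^ (n - k) * (R (ones k) * Ht (n - k))) = R (ones n @ [Dot 0])"
proof -
  have "(\<Sum>k=0..n. (-1) ^ (n - k) * (R (ones k) * Ht (n - k))) = R (ones n @ [Dot (n - n)])"
    by (rule alternating_sum_telescope)
      (simp_all add: R_Nil R_singleton Ht_def[of n] R_ones_mult_Ht Suc_diff_Suc del: replicate_Suc)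
  then show ?thesis by simp
qed

text \<open>For empty \<open>\<epsilon>\<close> this is the right-hand side of the theorem.  The suffix \<open>\<epsilon>\<close> gives
  products with \<open>H m\<close> the same form: a suffix \<open>1\<close> turns into \<open>1, m\<close> and into \<open>m + 1\<close>.\<close>

definition dotted_hooks :: "nat \<Rightarrow> dotted_composition \<Rightarrow> sNSym" where
  "dotted_hooks k \<epsilon> =
    (\<Sum>i=0..k. R (ones i @ [Dot 0] @ ones (k - i) @ \<epsilon>)) +
    (\<Sum>i=1..k. R (ones (i - 1) @ [Dot 1] @ ones (k - i) @ \<epsilon>))"

text \<open>Every composition ends with a \<open>1\<close>, except the two whose last entry is the dotted one.\<close>

lemma dotted_hooks_Suc:
  "dotted_hooks (Suc k) \<epsilon> =
    dotted_hooks k (Plain num.One # \<epsilon>) + R (ones (Suc k) @ Dot 0 # \<epsilon>) + R (ones k @ Dot 1 # \<epsilon>)"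
proof -
  have "ones (Suc k - i) @ \<epsilon> = ones (k - i) @ Plain num.One # \<epsilon>" if "i \<le> k" for i
    using that by (simp add: Suc_diff_le replicate_app_Cons_same)
  then have "(\<Sum>i=0..k. R (ones i @ [Dot 0] @ ones (Suc k - i) @ \<epsilon>)) =
        (\<Sum>i=0..k. R (ones i @ [Dot 0] @ ones (k - i) @ Plain num.One # \<epsilon>))"
      "(\<Sum>i=1..k. R (ones (i - 1) @ [Dot 1] @ ones (Suc k - i) @ \<epsilon>)) =
        (\<Sum>i=1..k. R (ones (i - 1) @ [Dot 1] @ ones (k - i) @ Plain num.One # \<epsilon>))"
    by (auto intro!: sum.cong)
  then show ?thesis
    unfolding dotted_hooks_def by (simp add: algebra_simps del: replicate_Suc)
qed

lemma dotted_hooks_ones_mult_H: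
  assumes "m > 0"
  shows "dotted_hooks k [Plain num.One] * H m =
    dotted_hooks k [Plain num.One, plain m] + dotted_hooks k [plain (Suc m)]"
proof -
  have "R (us @ [Plain num.One]) * H m = R (us @ [Plain num.One, plain m]) + R (us @ [plain (Suc m)])"
    for us using R_append_ones_mult_H[OF assms, of us 0] by simp
  from this[of "_ @ _ # ones _"] show ?thesis
    by (simp add: dotted_hooks_def distrib_right sum_distrib_right sum.distrib algebra_simps)
qed

text \<open>Here \<open>h\<close> collects two telescoping sequences.  The second summand consists of the terms that
  end with a separate undotted entry \<open>n - k\<close> and vanishes for \<open>k = n\<close>.  The first one comes from
  the factors that end with their dotted entry: a dotted \<open>0\<close> absorbs \<open>n - k\<close>, which
  belongs to \<open>h k\<close>; a dotted \<open>1\<close> becomes a dotted \<open>n - k + 1\<close>, which belongs to \<open>h (k - 1)\<close>.\<close>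

lemma alternating_sum_dotted_hooks_H:
  "(\<Sum>k=0..n. (-1) ^ (n - k) * (dotted_hooks k [] * H (n - k))) = R (ones n @ [Dot 0])"
proof -
  define h where "h k = R (ones k @ [Dot (n - k)]) +
    (if k < n then dotted_hooks k [plain (n - k)] else 0)" for k
  have "(\<Sum>k=0..n. (-1) ^ (n - k) * (dotted_hooks k [] * H (n - k))) = h n"
  proof (rule alternating_sum_telescope)
    show "dotted_hooks 0 [] * H (n - 0) = h 0"
      using R_snoc_Dot_mult_H[of n "[]" 0]
      by (cases "n = 0") (auto simp: h_def dotted_hooks_def H_def[of 0] add.commute)
    show "dotted_hooks (Suc k) [] * H (n - Suc k) = h (Suc k) + h k" if "k < n" for k
    proof (cases "Suc k = n")
      case True
      then show ?thesis
        by (auto simp: h_def H_def dotted_hooks_Suc algebra_simps simp del: replicate_Suc)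
    next
      case False
      then have m: "n - Suc k > 0" using that by simp
      from that have "n - k = Suc (n - Suc k)" by simp
      then show ?thesis
        using R_snoc_Dot_mult_H[OF m, of "ones (Suc k)" 0] R_snoc_Dot_mult_H[OF m, of "ones k" 1]
          that False
        by (simp add: h_def dotted_hooks_Suc dotted_hooks_ones_mult_H[OF m] distrib_right
            algebra_simps del: replicate_Suc)
    qed
  qed
  then show ?thesis by (simp add: h_def)
qed

lemma elementary_eq_ribbon_sums: "(\<lambda>n. R (ones n)) = S \<and> (\<lambda>n. dotted_hooks n []) = St"
proof (rule iffD1[OF elementary_iff], intro conjI allI impI)
  show "R (ones 0) = 1" by (simp add: R_Nil)
  show "(\<Sum>k=0..n. (-1) ^ (n - k) * (R (ones k) * H (n - k))) = 0" if "1 \<le> n" for n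
    using alternating_sum_R_ones_H[OF that] .
  show "(\<Sum>k=0..n. (-1) ^ (n - k) *
      (R (ones k) * Ht (n - k) - dotted_hooks k [] * H (n - k))) = 0" for n
    by (simp add: right_diff_distrib sum_subtractf alternating_sum_R_ones_Ht
        alternating_sum_dotted_hooks_H)
qed

theorem proposition6p7:
  fixes n :: nat
  assumes "n \<ge> 1"
  shows "St n =
      (\<Sum>k=0..n. R (replicate k (Plain num.One) @ [Dot 0] @ replicate (n - k) (Plain num.One)))
    + (\<Sum>k=1..n. R (replicate (k - 1) (Plain num.One) @ [Dot 1] @ replicate (n - k) (Plain num.One)))"
  using fun_cong[OF conjunct2[OF elementary_eq_ribbon_sums], of n]
  by (simp add: dotted_hooks_def)

end
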